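(* Let $n\ge 3$ be an integer. Let $X$ be a metric space and $A\subset X$ a subset consisting of at most $n$ points. Suppose that $Y$ is a Banach space. Then every $1$-Lipschitz map $f\colon A\to Y$ admits a Lipschitz extension $F\colon X\to Y$ with Lipschitz constant at most $$600\cdot\frac{\log(n)}{\log(\log(n))}.$$
   Context: $\log$ is the natural logarithm. *)

theory Defs
  imports "HOL-Analysis.Analysis"
begin

end

theory Submission
  imports Defs
begin

text \<open>For \<open>x\<close> at distance \<open>a > 0\<close> from \<open>A\<close>, let \<open>F x\<close> be the average of \<open>f\<close> over the points of \<open>A\<close>
  within distance \<open>R\<close> of \<open>x\<close>, where \<open>R\<close> is log-uniform on \<open>[a, L a]\<close>. Two nearby points \<open>x\<close> and \<open>y\<close>
  see different subsets of \<open>A\<close> at radius \<open>R\<close> only because of the \<open>t \<in> A\<close> for which \<open>R\<close> lies between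
  \<open>m t = min (dist x t) (dist y t)\<close> and the corresponding maximum, an interval of length at most
  \<open>dist x y\<close>. Each such \<open>t\<close> changes the average by \<open>O(R)\<close> divided by the number of points seen, and
  \<open>\<Sum>t. 1 / card {s. m s \<le> m t}\<close> is at most a harmonic number. Hence these changes contribute
  \<open>O(log n / log L)\<close> to the Lipschitz constant, while the two ends of the range of \<open>R\<close>
  contribute \<open>O(L / log L)\<close>. Take \<open>L = log n\<close>.\<close>

section \<open>Averages over finite sets\<close>

definition mean :: "('a \<Rightarrow> 'b::real_vector) \<Rightarrow> 'a set \<Rightarrow> 'b" where
  "mean f S = (\<Sum>s\<in>S. f s) /\<^sub>R real (card S)"

lemma mean_diff_const:
  assumes "finite S" "S \<noteq> {}"
  shows "mean f S - c = mean (\<lambda>s. f s - c) S"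
proof -
  have "card S \<noteq> 0" using assms by simp
  then show ?thesis
    by (simp add: mean_def sum_subtractf scaleR_diff_right sum_constant_scaleR)
qed

lemma norm_mean_diff_le:
  fixes f :: "'a \<Rightarrow> 'b::real_normed_vector"
  assumes "finite S" "S \<noteq> {}" and D: "\<And>s. s \<in> S \<Longrightarrow> norm (f s - c) \<le> D"
  shows "norm (mean f S - c) \<le> D"
proof -
  have pos: "0 < real (card S)" using assms by (simp add: card_gt_0_iff)
  have "norm (\<Sum>s\<in>S. f s - c) \<le> real (card S) * D"
    using sum_norm_bound[of S "\<lambda>s. f s - c" D] D by simp
  then show ?thesis
    unfolding mean_diff_const[OF assms(1,2)] unfolding mean_def norm_scaleR using pos
    by (simp only: abs_inverse abs_of_nat) (simp add: field_simps)
qed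

text \<open>The terms of \<open>S\<close> cancel: \<open>card U\<close> times
  \<open>mean f S - mean f U\<close> is the sum of \<open>mean f S - f u\<close> over
  \<open>u \<in> U - S\<close>, and each such term has norm at most \<open>D\<close>.\<close>

lemma norm_mean_subset_diff_le:
  fixes f :: "'a \<Rightarrow> 'b::real_normed_vector"
  assumes "finite U" "S \<subseteq> U" "S \<noteq> {}"
    and D: "\<And>s u. s \<in> S \<Longrightarrow> u \<in> U - S \<Longrightarrow> norm (f s - f u) \<le> D"
  shows "norm (mean f S - mean f U) \<le> D * card (U - S) / card U"
proof -
  have fin: "finite S" using assms finite_subset by blast
  have S0: "real (card S) \<noteq> 0" and U0: "0 < real (card U)"
    using assms fin by (auto simp: card_gt_0_iff)
  have card: "real (card U) = real (card S) + real (card (U - S))"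
    using assms fin by (simp add: card_Diff_subset card_mono)
  have "real (card U) *\<^sub>R mean f U = (\<Sum>s\<in>S. f s) + (\<Sum>u\<in>U - S. f u)"
    using U0 sum.subset_diff[OF assms(2,1), of f] by (auto simp: mean_def add.commute)
  also have "(\<Sum>s\<in>S. f s) = real (card S) *\<^sub>R mean f S"
    using S0 by (simp add: mean_def)
  finally have "real (card U) *\<^sub>R (mean f S - mean f U) = (\<Sum>u\<in>U - S. mean f S - f u)"
    by (simp add: card algebra_simps sum_subtractf sum_constant_scaleR)
  moreover have "norm (\<Sum>u\<in>U - S. mean f S - f u) \<le> real (card (U - S)) * D"
    by (intro sum_norm_bound norm_mean_diff_le fin assms(3) D)
  ultimately have "real (card U) * norm (mean f S - mean f U) \<le> real (card (U - S)) * D"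
    by (metis norm_scaleR abs_of_nat)
  then show ?thesis using U0 by (simp add: field_simps)
qed

text \<open>Add the points in increasing order of \<open>m\<close>. The newest point has rank
  \<open>k + 1\<close>, where \<open>k\<close> is the previous cardinality, and no earlier rank
  drops, so the sum grows by at most \<open>1 / (k + 1) \<le> ln (k + 1) - ln k\<close>.\<close>

lemma sum_inverse_rank_le:
  fixes m :: "'a \<Rightarrow> real"
  assumes "finite A" "A \<noteq> {}"
  shows "(\<Sum>t\<in>A. 1 / card {s\<in>A. m s \<le> m t}) \<le> 1 + ln (card A)"
  using assms
proof (induction A rule: finite_ranking_induct[where f = m])
  case empty
  then show ?case by simp
next
  case (insert x A)
  have all: "{s \<in> insert x A. m s \<le> m x} = insert x A"
    using insert.hyps by auto
  \<comment> \<open>The ranking induction does not say that \<open>x\<close> is new, so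
    \<open>x \<in> A\<close> is a separate case.\<close>
  consider "A = {}" | "x \<in> A" | "A \<noteq> {}" "x \<notin> A" by blast
  then show ?case
  proof cases
    case 1
    then show ?thesis using all by simp
  next
    case 2
    then show ?thesis using insert.IH by (auto simp: insert_absorb)
  next
    case 3
    then have k: "0 < real (card A)" using insert.hyps by (simp add: card_gt_0_iff)
    \<comment> \<open>Only points tied with \<open>x\<close> change rank, and their rank goes
      up.\<close>
    have "(\<Sum>t\<in>A. 1 / card {s\<in>insert x A. m s \<le> m t}) \<le> (\<Sum>t\<in>A. 1 / card {s\<in>A. m s \<le> m t})"
    proof (rule sum_mono)
      fix t assume "t \<in> A"
      then have "0 < card {s\<in>A. m s \<le> m t}"
        using insert.hyps by (auto simp: card_gt_0_iff)
      moreover have "card {s\<in>A. m s \<le> m t} \<le> card {s\<in>insert x A. m s \<le> m t}"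
        using insert.hyps by (intro card_mono) auto
      ultimately show "1 / real (card {s\<in>insert x A. m s \<le> m t}) \<le> 1 / real (card {s\<in>A. m s \<le> m t})"
        by (intro divide_left_mono) auto
    qed
    also have "\<dots> \<le> 1 + ln (card A)" using insert.IH 3 by simp
    finally have sum: "(\<Sum>t\<in>A. 1 / card {s\<in>insert x A. m s \<le> m t}) \<le> 1 + ln (card A)" .
    have "ln (real (card A) / (real (card A) + 1)) \<le> real (card A) / (real (card A) + 1) - 1"
      using k by (intro ln_le_minus_one) auto
    also have "\<dots> = - 1 / (real (card A) + 1)" using k by (simp add: field_simps)
    finally have "1 / (real (card A) + 1) \<le> ln (real (card A) + 1) - ln (real (card A))"
      using k by (simp add: ln_div)
    then show ?thesis
      using sum insert.hyps all 3 by (simp add: add.commute)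
  qed
qed

section \<open>Integration of ball averages against \<open>dR / R\<close>\<close>

text \<open>The integrand is a finite combination of the fixed vectors \<open>f t\<close> with real
  weights \<open>w t R\<close>, so it suffices that these weights are Borel measurable and bounded
  by \<open>1 / p\<close>.\<close>

lemma integrable_mean_cball:
  fixes f :: "'a::metric_space \<Rightarrow> 'b::banach"
  assumes "finite A" "0 < p"
  shows "(\<lambda>R. (1 / R) *\<^sub>R mean f (A \<inter> cball x R)) integrable_on {p..q}"
proof -
  \<comment> \<open>Counting by indicators makes measurability in \<open>R\<close> evident.\<close>
  define N where "N R = (\<Sum>s\<in>A. indicator {dist x s..} R :: real)" for R
  have card: "real (card (A \<inter> cball x R)) = N R" for R
  proof -
    have "N R = (\<Sum>s\<in>A. if s \<in> cball x R then 1 else 0)"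
      unfolding N_def by (intro sum.cong) (auto simp: indicator_def)
    also have "\<dots> = (\<Sum>s\<in>A \<inter> cball x R. 1)"
      using assms by (intro sum.inter_restrict[symmetric])
    finally show ?thesis by simp
  qed
  define w where "w t R = indicator {dist x t..} R / (R * N R)" for t R
  have eq: "(1 / R) *\<^sub>R mean f (A \<inter> cball x R) = (\<Sum>t\<in>A. w t R *\<^sub>R f t)" for R
  proof -
    have "(\<Sum>t\<in>A. w t R *\<^sub>R f t) = (\<Sum>t\<in>A. if t \<in> cball x R then (1 / (R * N R)) *\<^sub>R f t else 0)"
      unfolding w_def by (intro sum.cong) (auto simp: indicator_def)
    also have "\<dots> = (\<Sum>t\<in>A \<inter> cball x R. (1 / (R * N R)) *\<^sub>R f t)"
      using assms by (intro sum.inter_restrict[symmetric])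
    finally show ?thesis
      by (simp add: mean_def card scaleR_sum_right divide_inverse)
  qed
  have "w t integrable_on {p..q}" if "t \<in> A" for t
  proof (rule measurable_bounded_by_integrable_imp_integrable)
    have "w t \<in> borel_measurable borel" unfolding w_def N_def by measurable
    then show "w t \<in> borel_measurable (lebesgue_on {p..q})"
      by (intro measurable_restrict_space1) (auto intro: measurable_completion)
    show "(\<lambda>R. 1 / p) integrable_on {p..q}" by (intro integrable_const_ivl)
    fix R assume R: "R \<in> {p..q}"
    show "norm (w t R) \<le> 1 / p"
    proof (cases "dist x t \<le> R")
      case True
      \<comment> \<open>The weight of \<open>t\<close> is nonzero only when \<open>t\<close> itself
        is counted.\<close>
      have "1 \<le> N R"
        using True that assms card_gt_0_iff[of "A \<inter> cball x R"] unfolding card[symmetric] by auto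
      then have "p \<le> R * N R" using R assms mult_mono[of p R 1 "N R"] by simp
      then show ?thesis using True assms by (simp add: w_def divide_simps)
    next
      case False
      then show ?thesis using assms by (simp add: w_def)
    qed
  qed auto
  then show ?thesis
    unfolding eq using assms
    by (intro integrable_sum) (auto intro!: integrable_on_scaleR_left)
qed

lemma has_integral_inverse_ln:
  fixes p q :: real
  assumes "0 < p" "p \<le> q"
  shows "((\<lambda>R. 1 / R) has_integral (ln q - ln p)) {p..q}"
  using assms
  by (intro fundamental_theorem_of_calculus)
    (auto intro!: derivative_eq_intros simp: has_real_derivative_iff_has_vector_derivative[symmetric])

text \<open>Division by \<open>R\<close> turns the pointwise bound into
  \<open>\<alpha> + \<beta> / R\<close>, which integrates to the right-hand side;
  \<open>ln q - ln p\<close> is the total mass of \<open>dR / R\<close>.\<close>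

lemma norm_integral_mean_cball_diff_le:
  fixes f :: "'a::metric_space \<Rightarrow> 'b::banach"
  assumes "finite A" "0 < p" "p \<le> q"
    and le: "\<And>R. R \<in> {p..q} \<Longrightarrow> norm (mean f (A \<inter> cball x R) - c) \<le> \<alpha> * R + \<beta>"
  shows "norm (integral {p..q} (\<lambda>R. (1 / R) *\<^sub>R mean f (A \<inter> cball x R)) - (ln q - ln p) *\<^sub>R c)
    \<le> \<alpha> * (q - p) + \<beta> * (ln q - ln p)"
proof -
  note inv = has_integral_inverse_ln[OF assms(2,3)]
  have c: "((\<lambda>R. (1 / R) *\<^sub>R c) has_integral (ln q - ln p) *\<^sub>R c) {p..q}"
    using has_integral_scaleR_left[OF inv] .
  have const: "((\<lambda>R. \<alpha>) has_integral \<alpha> * (q - p)) {p..q}"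
    using assms has_integral_const_real[of \<alpha> p q] by (simp add: mult.commute)
  have g: "((\<lambda>R. \<alpha> + \<beta> * (1 / R)) has_integral \<alpha> * (q - p) + \<beta> * (ln q - ln p)) {p..q}"
    by (intro has_integral_add has_integral_mult_right inv const)
  have i: "((\<lambda>R. (1 / R) *\<^sub>R mean f (A \<inter> cball x R) - (1 / R) *\<^sub>R c) has_integral
      integral {p..q} (\<lambda>R. (1 / R) *\<^sub>R mean f (A \<inter> cball x R)) - (ln q - ln p) *\<^sub>R c) {p..q}"
    using integrable_mean_cball[OF assms(1,2)] c
    by (intro has_integral_diff integrable_integral) auto
  have "norm ((1 / R) *\<^sub>R mean f (A \<inter> cball x R) - (1 / R) *\<^sub>R c) \<le> \<alpha> + \<beta> * (1 / R)"
    if "R \<in> {p..q}" for R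
  proof -
    have "norm ((1 / R) *\<^sub>R mean f (A \<inter> cball x R) - (1 / R) *\<^sub>R c)
        = norm (mean f (A \<inter> cball x R) - c) / R"
      using that assms by (simp add: scaleR_diff_right[symmetric])
    also have "\<dots> \<le> (\<alpha> * R + \<beta>) / R"
      using le[OF that] that assms by (intro divide_right_mono) auto
    also have "\<dots> = \<alpha> + \<beta> * (1 / R)"
      using that assms by (simp add: add_divide_distrib)
    finally show ?thesis .
  qed
  then show ?thesis
    using integral_norm_bound_integral[OF has_integral_integrable[OF i] has_integral_integrable[OF g]]
    by (simp only: integral_unique[OF i] integral_unique[OF g])
qed

section \<open>Balls that meet a finite set, and comparison of their averages\<close>

lemma finite_infdist_attained:
  fixes A :: "'a::metric_space set"
  assumes "finite A" "A \<noteq> {}"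
  obtains t where "t \<in> A" "dist x t = infdist x A"
proof -
  have "infdist x A = Min (dist x ` A)"
    using assms by (simp add: infdist_notempty cInf_eq_Min)
  then have "infdist x A \<in> dist x ` A" using assms by simp
  then show thesis using that by auto
qed

lemma cball_meets:
  fixes A :: "'a::metric_space set"
  assumes "finite A" "A \<noteq> {}" "infdist x A \<le> R"
  shows "A \<inter> cball x R \<noteq> {}"
proof -
  obtain t where "t \<in> A" "dist x t = infdist x A"
    using finite_infdist_attained[OF assms(1,2)] .
  then show ?thesis using assms(3) by auto
qed

text \<open>Every averaged point is within \<open>R\<close> of \<open>x\<close>, hence within
  \<open>R + dist x t\<close> of \<open>t\<close>. The lower bound on \<open>R\<close> prevents an
  average over the empty set.\<close>

lemma norm_mean_cball_diff_le:
  fixes f :: "'a::metric_space \<Rightarrow> 'b::real_normed_vector"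
  assumes "finite A" "1-lipschitz_on A f" "t \<in> A" "infdist x A \<le> R"
  shows "norm (mean f (A \<inter> cball x R) - f t) \<le> R + dist x t"
proof (rule norm_mean_diff_le)
  show "A \<inter> cball x R \<noteq> {}" using assms by (intro cball_meets) auto
  fix s assume s: "s \<in> A \<inter> cball x R"
  then have "norm (f s - f t) \<le> dist s t"
    using lipschitz_onD[OF assms(2), of s t] assms(3) by (simp add: dist_norm)
  also have "\<dots> \<le> dist x s + dist x t" by (simp add: dist_triangle3)
  finally show "norm (f s - f t) \<le> R + dist x t" using s by simp
qed (use assms in auto)

text \<open>Both averages are compared with the one over the union \<open>U\<close> of the two sets.
  A point \<open>t\<close> seen from only one center has \<open>R\<close> between \<open>m t\<close>
  and \<open>M t\<close>, and \<open>U\<close> contains every \<open>s\<close> with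
  \<open>m s \<le> m t\<close>. So \<open>1 / card U\<close> is at most a weight independent of
  \<open>R\<close>, ready for integration.\<close>

lemma norm_mean_cball_pair_le:
  fixes f :: "'a::metric_space \<Rightarrow> 'b::real_normed_vector" and x y :: 'a
  defines "m \<equiv> \<lambda>t. min (dist x t) (dist y t)" and "M \<equiv> \<lambda>t. max (dist x t) (dist y t)"
  assumes "finite A" "A \<noteq> {}" "1-lipschitz_on A f"
    and R: "infdist x A \<le> R" "infdist y A \<le> R" "dist x y \<le> R"
  shows "norm (mean f (A \<inter> cball x R) - mean f (A \<inter> cball y R))
    \<le> 3 * R * (\<Sum>t\<in>A. if R \<in> {m t..M t} then 1 / card {s\<in>A. m s \<le> m t} else 0)"
proof -
  define S T U where "S = A \<inter> cball x R" and "T = A \<inter> cball y R" and "U = S \<union> T"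
  have fin: "finite U" "finite S" "finite T" using assms by (auto simp: S_def T_def U_def)
  have ne: "S \<noteq> {}" "T \<noteq> {}" using assms cball_meets unfolding S_def T_def by blast+
  have R0: "0 \<le> R" using R(3) zero_le_dist[of x y] by linarith
  have st: "norm (f s - f t) \<le> 3 * R" "norm (f t - f s) \<le> 3 * R" if "s \<in> S" "t \<in> T" for s t
  proof -
    have "norm (f s - f t) \<le> dist s t"
      using lipschitz_onD[OF assms(5), of s t] that by (simp add: dist_norm S_def T_def)
    \<comment> \<open>The path from \<open>s\<close> to \<open>t\<close> through \<open>x\<close>
      and \<open>y\<close> has three legs, each of length at most \<open>R\<close>.\<close>
    also have "\<dots> \<le> dist x s + dist x y + dist y t"
      using dist_triangle[of s t x] dist_triangle[of x t y] by (simp add: dist_commute)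
    finally show "norm (f s - f t) \<le> 3 * R" using that R by (simp add: S_def T_def)
    then show "norm (f t - f s) \<le> 3 * R" by (simp add: norm_minus_commute)
  qed
  have "norm (mean f S - mean f U) \<le> 3 * R * card (U - S) / card U"
    using fin ne st by (intro norm_mean_subset_diff_le) (auto simp: U_def)
  moreover have "norm (mean f T - mean f U) \<le> 3 * R * card (U - T) / card U"
    using fin ne st by (intro norm_mean_subset_diff_le) (auto simp: U_def)
  moreover have "norm (mean f S - mean f T) \<le> norm (mean f S - mean f U) + norm (mean f T - mean f U)"
    by (metis dist_norm dist_triangle2)
  ultimately have "norm (mean f S - mean f T) \<le> 3 * R * ((real (card (U - S)) + real (card (U - T))) / card U)"
    by (simp add: add_divide_distrib distrib_left)
  also have "real (card (U - S)) + real (card (U - T)) = real (card ((U - S) \<union> (U - T)))"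
    using fin by (subst card_Un_disjoint) (auto simp: U_def)
  also have "real (card ((U - S) \<union> (U - T))) / card U = (\<Sum>t\<in>(U - S) \<union> (U - T). 1 / card U)"
    by simp
  also have "\<dots> \<le> (\<Sum>t\<in>(U - S) \<union> (U - T). if R \<in> {m t..M t} then 1 / card {s\<in>A. m s \<le> m t} else 0)"
  proof (rule sum_mono)
    fix t assume t: "t \<in> (U - S) \<union> (U - T)"
    then have tA: "t \<in> A" and tR: "R \<in> {m t..M t}"
      by (auto simp: U_def S_def T_def m_def M_def)
    have "card {s\<in>A. m s \<le> m t} \<le> card U"
      using tR fin by (intro card_mono) (auto simp: U_def S_def T_def m_def)
    moreover have "0 < card {s\<in>A. m s \<le> m t}" using tA \<open>finite A\<close> unfolding card_gt_0_iff by auto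
    ultimately show "1 / real (card U) \<le> (if R \<in> {m t..M t} then 1 / card {s\<in>A. m s \<le> m t} else 0)"
      using tR by (simp add: frac_le)
  qed
  also have "\<dots> \<le> (\<Sum>t\<in>A. if R \<in> {m t..M t} then 1 / card {s\<in>A. m s \<le> m t} else 0)"
    using assms by (intro sum_mono2) (auto simp: U_def S_def T_def)
  finally show ?thesis using R0 by (simp add: S_def T_def mult_left_mono)
qed

text \<open>The factor \<open>R\<close> in the pointwise bound cancels against
  \<open>dR / R\<close>. Each \<open>t\<close> then contributes its weight times the length of an
  interval no longer than \<open>dist x y\<close>, and the weights add up to at most
  \<open>1 + ln (card A)\<close>.\<close>

lemma norm_integral_mean_cball_pair_le:
  fixes f :: "'a::metric_space \<Rightarrow> 'b::banach"
  assumes "finite A" "A \<noteq> {}" "1-lipschitz_on A f" "0 < p"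
    and p: "infdist x A \<le> p" "infdist y A \<le> p" "dist x y \<le> p"
  shows "norm (integral {p..q} (\<lambda>R. (1 / R) *\<^sub>R mean f (A \<inter> cball x R)) -
      integral {p..q} (\<lambda>R. (1 / R) *\<^sub>R mean f (A \<inter> cball y R)))
    \<le> 3 * (1 + ln (card A)) * dist x y"
proof -
  define m M where "m t = min (dist x t) (dist y t)" and "M t = max (dist x t) (dist y t)" for t
  define w where "w t = 1 / real (card {s\<in>A. m s \<le> m t})" for t
  define h where "h t R = (if R \<in> {m t..M t} then w t else 0)" for t R
  have h: "h t integrable_on {p..q}" "integral {p..q} (h t) \<le> w t * dist x y" for t
  proof -
    have "0 \<le> w t" by (simp add: w_def)
    have len: "M t - m t \<le> dist x y"
      using abs_dist_diff_le[of x t y] by (auto simp: m_def M_def min_def max_def dist_commute)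
    have "((\<lambda>_. w t) has_integral measure lborel {max (m t) p..min (M t) q} *\<^sub>R w t) ({m t..M t} \<inter> {p..q})"
      unfolding Int_atLeastAtMost by (rule has_integral_const_real)
    then have "(h t has_integral measure lborel {max (m t) p..min (M t) q} *\<^sub>R w t) {p..q}"
      unfolding h_def by (simp only: has_integral_restrict_Int)
    moreover have "measure lborel {max (m t) p..min (M t) q} \<le> dist x y"
      using len by auto
    ultimately show "h t integrable_on {p..q}" "integral {p..q} (h t) \<le> w t * dist x y"
      using \<open>0 \<le> w t\<close> by (auto simp: has_integral_iff mult.commute intro: mult_left_mono)
  qed
  have i: "(\<lambda>R. (1 / R) *\<^sub>R mean f (A \<inter> cball z R)) integrable_on {p..q}" for z
    using assms by (intro integrable_mean_cball) auto
  have "norm (integral {p..q} (\<lambda>R. (1 / R) *\<^sub>R mean f (A \<inter> cball x R) - (1 / R) *\<^sub>R mean f (A \<inter> cball y R)))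
      \<le> integral {p..q} (\<lambda>R. 3 * (\<Sum>t\<in>A. h t R))"
  proof (rule integral_norm_bound_integral)
    fix R assume R: "R \<in> {p..q}"
    have "norm ((1 / R) *\<^sub>R mean f (A \<inter> cball x R) - (1 / R) *\<^sub>R mean f (A \<inter> cball y R))
        = norm (mean f (A \<inter> cball x R) - mean f (A \<inter> cball y R)) / R"
      using R assms by (simp add: scaleR_diff_right[symmetric])
    also have "\<dots> \<le> (3 * R * (\<Sum>t\<in>A. h t R)) / R"
      using R assms norm_mean_cball_pair_le[OF assms(1-3), of x R y]
      unfolding h_def w_def m_def M_def by (intro divide_right_mono) simp_all
    also have "\<dots> = 3 * (\<Sum>t\<in>A. h t R)" using R assms by simp
    finally show "norm ((1 / R) *\<^sub>R mean f (A \<inter> cball x R) - (1 / R) *\<^sub>R mean f (A \<inter> cball y R))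
        \<le> 3 * (\<Sum>t\<in>A. h t R)" .
  qed (use assms h(1) i in \<open>auto intro!: integrable_diff integrable_on_mult_right integrable_sum\<close>)
  also have "\<dots> = 3 * (\<Sum>t\<in>A. integral {p..q} (h t))"
    using assms h(1) by (simp add: integral_sum)
  also have "\<dots> \<le> 3 * (\<Sum>t\<in>A. w t * dist x y)"
    using h(2) by (intro mult_left_mono sum_mono) auto
  also have "\<dots> = 3 * (\<Sum>t\<in>A. w t) * dist x y" by (simp add: sum_distrib_right)
  also have "\<dots> \<le> 3 * (1 + ln (card A)) * dist x y"
    using sum_inverse_rank_le[OF assms(1,2), of m]
    by (intro mult_right_mono mult_left_mono) (auto simp: w_def)
  finally show ?thesis by (simp add: integral_diff[OF i i])
qed

section \<open>The extension and its Lipschitz constant\<close>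

text \<open>Normalizing by \<open>ln L\<close>, the mass of \<open>dR / R\<close> on the interval,
  gives a true average. The interval collapses to a point on \<open>A\<close>, so \<open>f\<close>
  is prescribed there separately.\<close>

definition mean_extension :: "real \<Rightarrow> 'a::metric_space set \<Rightarrow> ('a \<Rightarrow> 'b::banach) \<Rightarrow> 'a \<Rightarrow> 'b" where
  "mean_extension L A f x = (if x \<in> A then f x else
    integral {infdist x A..L * infdist x A} (\<lambda>R. (1 / R) *\<^sub>R mean f (A \<inter> cball x R)) /\<^sub>R ln L)"

lemma infdist_finite_pos:
  fixes A :: "'a::metric_space set"
  assumes "finite A" "A \<noteq> {}" "x \<notin> A"
  shows "0 < infdist x A"
proof -
  obtain t where "t \<in> A" "dist x t = infdist x A"
    using finite_infdist_attained[OF assms(1,2)] .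
  then show ?thesis using assms(3) by (metis zero_less_dist_iff)
qed

text \<open>With \<open>a = infdist x A > 0\<close>, the pointwise bound \<open>R + dist x t\<close>
  integrates to \<open>(L - 1) * a + dist x t * ln L\<close>; then divide by
  \<open>ln L\<close>.\<close>

lemma dist_mean_extension_point_le:
  fixes f :: "'a::metric_space \<Rightarrow> 'b::banach"
  assumes "finite A" "1-lipschitz_on A f" "1 < L" "t \<in> A"
  shows "dist (mean_extension L A f x) (f t) \<le> L * infdist x A / ln L + dist x t"
proof (cases "x \<in> A")
  case True
  then have "dist (f x) (f t) \<le> dist x t" using lipschitz_onD[OF assms(2)] assms(4) by auto
  then show ?thesis using True assms by (simp add: mean_extension_def)
next
  case False
  define a where "a = infdist x A"
  have a: "0 < a" using infdist_finite_pos[OF assms(1) _ False] assms(4) a_def by auto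
  have l: "0 < ln L" using assms by simp
  define I where "I = integral {a..L * a} (\<lambda>R. (1 / R) *\<^sub>R mean f (A \<inter> cball x R))"
  have "norm (I - (ln (L * a) - ln a) *\<^sub>R f t) \<le> 1 * (L * a - a) + dist x t * (ln (L * a) - ln a)"
    unfolding I_def
  proof (rule norm_integral_mean_cball_diff_le)
    fix R assume "R \<in> {a..L * a}"
    then show "norm (mean f (A \<inter> cball x R) - f t) \<le> 1 * R + dist x t"
      using norm_mean_cball_diff_le[OF assms(1,2,4)] by (simp add: a_def)
  qed (use assms a in auto)
  also have "ln (L * a) - ln a = ln L" using a assms by (simp add: ln_mult)
  finally have "norm (I - ln L *\<^sub>R f t) \<le> L * a + dist x t * ln L" using a by simp
  moreover have "dist (mean_extension L A f x) (f t) = norm (I - ln L *\<^sub>R f t) / ln L"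
  proof -
    have "I /\<^sub>R ln L - f t = (I - ln L *\<^sub>R f t) /\<^sub>R ln L"
      using l by (simp add: scaleR_diff_right)
    then show ?thesis
      using False l by (simp add: mean_extension_def dist_norm I_def a_def divide_inverse mult.commute)
  qed
  ultimately show ?thesis using l by (simp add: a_def field_simps)
qed

text \<open>The ranges \<open>[a, L a]\<close> and \<open>[b, L b]\<close> overlap in
  \<open>[b, L a]\<close>, where the averages are compared at equal radius. The leftover pieces
  \<open>[a, b]\<close> and \<open>[L a, L b]\<close> have the same mass for \<open>dR / R\<close>,
  so comparing both with \<open>f t\<close>, for \<open>t\<close> nearest to \<open>x\<close>, makes
  the reference terms cancel.\<close>

lemma dist_mean_extension_near_le:
  fixes f :: "'a::metric_space \<Rightarrow> 'b::banach"
  assumes "finite A" "A \<noteq> {}" "1-lipschitz_on A f" "2 \<le> L"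
    and near: "infdist x A \<le> infdist y A" "dist x y < infdist x A"
  shows "dist (mean_extension L A f x) (mean_extension L A f y)
    \<le> (2 + 3 * L + 3 * (1 + ln (card A))) / ln L * dist x y"
proof -
  define a b where "a = infdist x A" and "b = infdist y A"
  have a: "0 < a" using near zero_le_dist[of x y] unfolding a_def by linarith
  have ab: "a \<le> b" "b \<le> a + dist x y" "dist x y \<le> a"
    using near infdist_triangle[of y A x] by (auto simp: a_def b_def dist_commute)
  \<comment> \<open>This is where \<open>2 \<le> L\<close> enters: it gives
    \<open>b \<le> 2 * a \<le> L * a\<close>, and later \<open>dist y t \<le> R\<close> on the upper
    piece.\<close>
  have La: "2 * a \<le> L * a" using a assms by simp
  have b: "b \<le> L * a" "L * a \<le> L * b" using ab La assms by auto
  have l: "0 < ln L" using assms by simp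
  have notin: "x \<notin> A" "y \<notin> A" using a ab by (auto simp: a_def b_def)
  define g where "g z R = (1 / R) *\<^sub>R mean f (A \<inter> cball z R)" for z R
  have gi: "g z integrable_on {p..q}" if "0 < p" for z p q
    unfolding g_def using integrable_mean_cball[OF assms(1) that] .
  obtain t where t: "t \<in> A" "dist x t = a"
    using finite_infdist_attained[OF assms(1,2)] a_def by metis
  have yt: "dist y t \<le> 2 * a"
    using dist_triangle[of y t x] t ab by (simp add: dist_commute)
  \<comment> \<open>On \<open>[a, b]\<close> one has \<open>dist x t = a \<le> R\<close>, so no
    constant term \<open>\<beta>\<close> remains.\<close>
  have 1: "norm (integral {a..b} (g x) - (ln b - ln a) *\<^sub>R f t) \<le> 2 * (b - a) + 0 * (ln b - ln a)"
    unfolding g_def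
  proof (rule norm_integral_mean_cball_diff_le)
    fix R assume "R \<in> {a..b}"
    then show "norm (mean f (A \<inter> cball x R) - f t) \<le> 2 * R + 0"
      using norm_mean_cball_diff_le[OF assms(1,3) t(1), of x R] t a_def by auto
  qed (use a ab assms in auto)
  have 2: "norm (integral {b..L * a} (g x) - integral {b..L * a} (g y)) \<le> 3 * (1 + ln (card A)) * dist x y"
    unfolding g_def using a ab
    by (intro norm_integral_mean_cball_pair_le assms) (auto simp: a_def b_def)
  have 3: "norm (integral {L * a..L * b} (g y) - (ln (L * b) - ln (L * a)) *\<^sub>R f t)
      \<le> 3 * (L * b - L * a) + 0 * (ln (L * b) - ln (L * a))"
    unfolding g_def
  proof (rule norm_integral_mean_cball_diff_le)
    fix R assume "R \<in> {L * a..L * b}"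
    then have "b \<le> R" "2 * a \<le> R" using b La by auto
    then show "norm (mean f (A \<inter> cball y R) - f t) \<le> 3 * R + 0"
      using norm_mean_cball_diff_le[OF assms(1,3) t(1), of y R] yt a b_def by auto
  qed (use a b assms in auto)
  have ln: "ln (L * b) - ln (L * a) = ln b - ln a"
    using a ab assms by (simp add: ln_mult)
  have x: "integral {a..L * a} (g x) = integral {a..b} (g x) + integral {b..L * a} (g x)"
    using ab b gi a by (simp add: Henstock_Kurzweil_Integration.integral_combine)
  have y: "integral {b..L * b} (g y) = integral {b..L * a} (g y) + integral {L * a..L * b} (g y)"
    using ab b gi a by (simp add: Henstock_Kurzweil_Integration.integral_combine)
  have "integral {a..L * a} (g x) - integral {b..L * b} (g y) =
      (integral {a..b} (g x) - (ln b - ln a) *\<^sub>R f t) +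
      (integral {b..L * a} (g x) - integral {b..L * a} (g y)) -
      (integral {L * a..L * b} (g y) - (ln (L * b) - ln (L * a)) *\<^sub>R f t)"
    unfolding ln x y by simp
  also have "norm \<dots> \<le> 2 * (b - a) + 3 * (1 + ln (card A)) * dist x y + 3 * (L * b - L * a)"
    using norm_triangle_le_diff[OF add_mono[OF norm_triangle_mono[OF 1 2] 3]] by simp
  also have "\<dots> = (2 + 3 * L) * (b - a) + 3 * (1 + ln (card A)) * dist x y"
    by (simp add: algebra_simps)
  also have "\<dots> \<le> (2 + 3 * L) * dist x y + 3 * (1 + ln (card A)) * dist x y"
    using ab assms by (intro add_right_mono mult_left_mono) auto
  also have "\<dots> = (2 + 3 * L + 3 * (1 + ln (card A))) * dist x y"
    by (simp add: algebra_simps)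
  finally have "norm (integral {a..L * a} (g x) - integral {b..L * b} (g y)) / ln L
      \<le> (2 + 3 * L + 3 * (1 + ln (card A))) * dist x y / ln L"
    using l by (intro divide_right_mono) auto
  moreover have "dist (mean_extension L A f x) (mean_extension L A f y)
      = norm (integral {a..L * a} (g x) - integral {b..L * b} (g y)) / ln L"
    using notin l unfolding mean_extension_def a_def b_def g_def
    by (simp add: dist_norm scaleR_diff_right[symmetric] divide_inverse mult.commute)
  ultimately show ?thesis by simp
qed

text \<open>By symmetry let \<open>x\<close> be the point closer to \<open>A\<close>. If
  \<open>dist x y < infdist x A\<close>, the previous estimate applies and gives the fraction.
  Otherwise both points are within \<open>2 * dist x y\<close> of \<open>A\<close>, and a detour
  through \<open>f t\<close> for \<open>t\<close> nearest to \<open>x\<close> costs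
  \<open>3 + 3 * L / ln L\<close>.\<close>

lemma lipschitz_on_mean_extension:
  fixes f :: "'a::metric_space \<Rightarrow> 'b::banach"
  assumes "finite A" "A \<noteq> {}" "1-lipschitz_on A f" "2 \<le> L"
  shows "(3 + (2 + 3 * L + 3 * (1 + ln (card A))) / ln L)-lipschitz_on UNIV (mean_extension L A f)"
    (is "?K-lipschitz_on UNIV ?F")
proof -
  have l: "0 < ln L" using assms by simp
  have n: "0 \<le> ln (real (card A))"
    using assms by (metis One_nat_def Suc_leI card_gt_0_iff ln_ge_zero of_nat_1 of_nat_mono)
  have *: "dist (?F x) (?F y) \<le> ?K * dist x y" if le: "infdist x A \<le> infdist y A" for x y
  proof (cases "dist x y < infdist x A")
    case True
    have "dist (?F x) (?F y) \<le> (2 + 3 * L + 3 * (1 + ln (card A))) / ln L * dist x y"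
      using dist_mean_extension_near_le[OF assms le True] .
    also have "\<dots> \<le> ?K * dist x y" by (intro mult_right_mono) auto
    finally show ?thesis .
  next
    case False
    define d where "d = dist x y"
    obtain t where t: "t \<in> A" "dist x t = infdist x A"
      using finite_infdist_attained[OF assms(1,2)] by metis
    have x: "infdist x A \<le> d" and y: "infdist y A \<le> 2 * d"
      using False infdist_triangle[of y A x] by (auto simp: d_def dist_commute)
    have yt: "dist y t \<le> 2 * d"
      using dist_triangle[of y t x] t x by (simp add: d_def dist_commute)
    have "dist (?F x) (?F y) \<le> dist (?F x) (f t) + dist (?F y) (f t)"
      by (rule dist_triangle2)
    also have "\<dots> \<le> (L * infdist x A / ln L + dist x t) + (L * infdist y A / ln L + dist y t)"
      using assms t by (intro add_mono dist_mean_extension_point_le) auto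
    also have "\<dots> \<le> (L * d / ln L + d) + (L * (2 * d) / ln L + 2 * d)"
      using x y yt t l assms by (intro add_mono divide_right_mono mult_left_mono) auto
    also have "\<dots> = (3 + 3 * L / ln L) * d" by (simp add: algebra_simps add_divide_distrib)
    also have "\<dots> \<le> ?K * d"
      using l n by (intro mult_right_mono add_left_mono divide_right_mono) (auto simp: d_def)
    finally show ?thesis by (simp add: d_def)
  qed
  show ?thesis
  proof (rule lipschitz_onI)
    fix x y
    show "dist (?F x) (?F y) \<le> ?K * dist x y"
      using *[of x y] *[of y x] by (cases "infdist x A \<le> infdist y A") (auto simp: dist_commute)
    show "0 \<le> ?K" using l n assms by auto
  qed
qed

section \<open>Choice of \<open>L\<close> and numerical constants\<close>

theorem theorem1p5:
  fixes n :: nat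
    and A :: "'a::metric_space set"
    and f :: "'a \<Rightarrow> 'b::banach"
  assumes "n \<ge> 3"
    and "finite A" and "card A \<le> n"
    and "1-lipschitz_on A f"
  shows "\<exists>F :: 'a \<Rightarrow> 'b.
           (600 * (ln (real n) / ln (ln (real n))))-lipschitz_on UNIV F \<and>
           (\<forall>x\<in>A. F x = f x)"
proof -
  define l where "l = ln (real n)"
  \<comment> \<open>Since \<open>n\<close> exceeds \<open>e\<close>, the iterated logarithm is
    positive.\<close>
  have "exp 1 < real n"
    using \<open>n \<ge> 3\<close> e_less_272 by linarith
  then have l1: "1 < l"
    using ln_less_cancel_iff[of "exp 1" "real n"] \<open>n \<ge> 3\<close> by (simp add: l_def)
  then have ll: "0 < ln l" "1 \<le> l / ln l" using ln_le_minus_one[of l] by (auto simp: le_divide_eq)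
  show ?thesis
  proof (cases "A = {}")
    case True
    have "0 \<le> 600 * (l / ln l)" using ll(2) by linarith
    then have "(600 * (l / ln l))-lipschitz_on UNIV (\<lambda>_::'a. 0::'b)"
      by (intro lipschitz_on_le[OF lipschitz_on_constant])
    then show ?thesis using True l_def by auto
  next
    case False
    \<comment> \<open>The maximum with \<open>e\<close> ensures \<open>ln L \<ge> 1\<close> even
      when \<open>l\<close> is close to 1, where \<open>ln l\<close> is nearly 0.\<close>
    define L where "L = max (exp 1) l"
    have L: "2 \<le> L" using exp_ge_add_one_self[of 1] by (auto simp: L_def)
    have "3 + (2 + 3 * L + 3 * (1 + ln (card A))) / ln L \<le> 3 + (2 + 3 * L + 3 * (1 + l)) / ln L"
      using L False assms
      by (intro add_left_mono divide_right_mono mult_left_mono) (auto simp: l_def card_gt_0_iff)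
    also have "\<dots> \<le> 600 * (l / ln l)"
    proof (cases "l \<le> exp 1")
      case True
      then have "L = exp 1" by (simp add: L_def)
      \<comment> \<open>Here \<open>ln L = 1\<close>; the sum is bounded by an absolute constant and
        \<open>l / ln l \<ge> 1\<close>.\<close>
      then have "3 + (2 + 3 * L + 3 * (1 + l)) / ln L = 8 + 3 * exp 1 + 3 * l" by simp
      also have "\<dots> \<le> 600" using exp_le True by linarith
      finally show ?thesis using ll(2) by linarith
    next
      case False
      then have "L = l" "1 \<le> ln l" using l1 by (auto simp: L_def ln_ge_iff)
      \<comment> \<open>Both 3 and \<open>5 / ln l\<close> are absorbed into multiples of
        \<open>l / ln l\<close>, for a total of at most \<open>14 * (l / ln l)\<close>.\<close>
      moreover have "5 / ln l \<le> 5 * (l / ln l)" using l1 ll by (simp add: divide_simps)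
      moreover have "(2 + 3 * l + 3 * (1 + l)) / ln l = 5 / ln l + 6 * (l / ln l)"
        by (simp add: add_divide_distrib[symmetric])
      ultimately show ?thesis using ll(2) by (simp only:)
    qed
    finally have "(600 * (l / ln l))-lipschitz_on UNIV (mean_extension L A f)"
      by (rule lipschitz_on_le[OF lipschitz_on_mean_extension[OF assms(2) False assms(4) L]])
    then show ?thesis
      unfolding l_def by (intro exI[of _ "mean_extension L A f"]) (simp add: mean_extension_def)
  qed
qed

end
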